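(* There exist three invertible pairs $(f_j,g_j)\in U_2(A_{\mathbb{R}}(\mathbb{D}))$, $j=1,2,3$, such that each of $\{(f_1,g_1),(f_2,g_2)\}$, $\{(f_1,g_1),(f_3,g_3)\}$ and $\{(f_2,g_2),(f_3,g_3)\}$ is sign-linked, but the three pairs are not simultaneously stabilizable; that is, there is no $(\alpha,\beta)\in A_{\mathbb{R}}(\mathbb{D})^2$ such that $\alpha f_j+\beta g_j\in A_{\mathbb{R}}(\mathbb{D})^{-1}$ for all $j=1,2,3$.
   Context: $\mathbb{D}$ is the open unit disc in $\mathbb{C}$. The disc algebra $A(\mathbb{D})$ is the algebra of functions continuous on $\overline{\mathbb{D}}$ and holomorphic in $\mathbb{D}$. $A_{\mathbb{R}}(\mathbb{D})$ is the real algebra of all $f\in A(\mathbb{D})$ with $f(z)=\overline{f(\overline{z})}$ for all $z\in\overline{\mathbb{D}}$, and $A_{\mathbb{R}}(\mathbb{D})^{-1}$ is its set of invertible elements. Functions in $A_{\mathbb{R}}(\mathbb{D})$ are real-valued on $[-1,1]$. A pair $(f,g)\in A_{\mathbb{R}}(\mathbb{D})^2$ is invertible if there exist $\alpha,\beta\in A_{\mathbb{R}}(\mathbb{D})$ with $\alpha f+\beta g=1$; the set of invertible pairs is denoted $U_2(A_{\mathbb{R}}(\mathbb{D}))$. Two invertible pairs $(f_1,g_1)$, $(f_2,g_2)$ are called sign-linked if the following holds. Let $S$ be the set of $x\in[-1,1]$ at which the matrix $\begin{pmatrix} f_1(x)& g_1(x)\\ f_2(x)&g_2(x)\end{pmatrix}$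 is singular. For each $x\in S$ there is a unique real number $\lambda(x)$ with $(f_2(x),g_2(x))=\lambda(x)\,(f_1(x),g_1(x))$, and $\lambda(x)\ne 0$. The requirement is that $\lambda$ has constant sign on $S$: either $\lambda(x)>0$ for all $x\in S$, or $\lambda(x)<0$ for all $x\in S$ (vacuously satisfied if $S=\emptyset$). This relation is symmetric in the two pairs. *)

theory Defs
  imports "HOL-Complex_Analysis.Complex_Analysis"
begin

text \<open>
  Elements of the disc algebra are represented by total functions; only their values on the closed
  unit disc matter. Accordingly all identities between elements of the algebra are required
  on \<^term>\<open>cball (0::complex) 1\<close> only.
\<close>

definition disc_algebra :: "(complex \<Rightarrow> complex) set" where
  "disc_algebra = {f. continuous_on (cball 0 1) f \<and> f holomorphic_on ball 0 1}"

definition real_disc_algebra :: "(complex \<Rightarrow> complex) set" where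
  "real_disc_algebra = {f \<in> disc_algebra. \<forall>z\<in>cball 0 1. f z = cnj (f (cnj z))}"

definition real_disc_units :: "(complex \<Rightarrow> complex) set" where
  "real_disc_units =
     {f \<in> real_disc_algebra. \<exists>h\<in>real_disc_algebra. \<forall>z\<in>cball 0 1. f z * h z = 1}"

definition invertible_pairs :: "((complex \<Rightarrow> complex) \<times> (complex \<Rightarrow> complex)) set" where
  "invertible_pairs =
     {(f, g). f \<in> real_disc_algebra \<and> g \<in> real_disc_algebra \<and>
        (\<exists>\<alpha>\<in>real_disc_algebra. \<exists>\<beta>\<in>real_disc_algebra.
           \<forall>z\<in>cball 0 1. \<alpha> z * f z + \<beta> z * g z = 1)}"

definition singular_points ::
  "(complex \<Rightarrow> complex) \<times> (complex \<Rightarrow> complex) \<Rightarrow>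
   (complex \<Rightarrow> complex) \<times> (complex \<Rightarrow> complex) \<Rightarrow> real set" where
  "singular_points = (\<lambda>(f1, g1) (f2, g2).
     {x \<in> {-1..1}.
        \<not> invertible (vector [vector [f1 (of_real x), g1 (of_real x)],
                          vector [f2 (of_real x), g2 (of_real x)]] :: complex^2^2)})"

definition is_ratio_at ::
  "(complex \<Rightarrow> complex) \<times> (complex \<Rightarrow> complex) \<Rightarrow>
   (complex \<Rightarrow> complex) \<times> (complex \<Rightarrow> complex) \<Rightarrow> real \<Rightarrow> real \<Rightarrow> bool" where
  "is_ratio_at = (\<lambda>(f1, g1) (f2, g2) x l.
     f2 (of_real x) = of_real l * f1 (of_real x) \<and> g2 (of_real x) = of_real l * g1 (of_real x))"

text \<open>
  The definition is meant for invertible pairs: there the function \<open>l\<close> is uniquely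
  determined on the singular set and has no zeros on it, as proved in \<open>ratio_unique\<close> below.
\<close>

definition sign_linked ::
  "(complex \<Rightarrow> complex) \<times> (complex \<Rightarrow> complex) \<Rightarrow>
   (complex \<Rightarrow> complex) \<times> (complex \<Rightarrow> complex) \<Rightarrow> bool" where
  "sign_linked p q \<longleftrightarrow>
     (\<exists>l :: real \<Rightarrow> real. (\<forall>x\<in>singular_points p q. is_ratio_at p q x (l x)) \<and>
        ((\<forall>x\<in>singular_points p q. l x > 0) \<or> (\<forall>x\<in>singular_points p q. l x < 0)))"

definition simultaneously_stabilizable ::
  "((complex \<Rightarrow> complex) \<times> (complex \<Rightarrow> complex)) set \<Rightarrow> bool" where
  "simultaneously_stabilizable P \<longleftrightarrow>
     (\<exists>\<alpha>\<in>real_disc_algebra. \<exists>\<beta>\<in>real_disc_algebra.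
        \<forall>(f, g)\<in>P. (\<lambda>z. \<alpha> z * f z + \<beta> z * g z) \<in> real_disc_units)"

lemma real_disc_algebra_real_on_interval:
  assumes "f \<in> real_disc_algebra" "x \<in> {-1..1}"
  shows "f (of_real x) = of_real (Re (f (of_real x)))"
proof -
  have "of_real x \<in> cball (0::complex) 1"
    using assms(2) by auto
  then have "f (of_real x) = cnj (f (of_real x))"
    using assms(1) unfolding real_disc_algebra_def by fastforce
  then show ?thesis
    by (metis Reals_cnj_iff of_real_Re)
qed

lemma invertible_pairs_no_common_zero:
  assumes "(f, g) \<in> invertible_pairs" "z \<in> cball 0 1"
  shows "f z \<noteq> 0 \<or> g z \<noteq> 0"
proof -
  obtain \<alpha> \<beta> where "\<forall>z\<in>cball 0 1. \<alpha> z * f z + \<beta> z * g z = 1"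
    using assms(1) by (auto simp: invertible_pairs_def)
  then have "\<alpha> z * f z + \<beta> z * g z = 1"
    using assms(2) by blast
  then show ?thesis
    by auto
qed

lemma ratio_unique:
  assumes p: "p \<in> invertible_pairs" and q: "q \<in> invertible_pairs"
    and x: "x \<in> singular_points p q"
  shows "\<exists>!l. is_ratio_at p q x l" and "is_ratio_at p q x l \<Longrightarrow> l \<noteq> 0"
proof -
  obtain f1 g1 f2 g2 where pq: "p = (f1, g1)" "q = (f2, g2)"
    by (metis surj_pair)
  have xi: "x \<in> {-1..1}" and cb: "of_real x \<in> cball (0::complex) 1"
    using x by (auto simp: pq singular_points_def)
  have alg: "f1 \<in> real_disc_algebra" "g1 \<in> real_disc_algebra"
      "f2 \<in> real_disc_algebra" "g2 \<in> real_disc_algebra"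
    using p q by (auto simp: pq invertible_pairs_def)
  obtain a b c d where
    r: "f1 (of_real x) = of_real a" "g1 (of_real x) = of_real b"
       "f2 (of_real x) = of_real c" "g2 (of_real x) = of_real d"
    using alg real_disc_algebra_real_on_interval[OF _ xi] by blast
  have nz1: "a \<noteq> 0 \<or> b \<noteq> 0"
    using invertible_pairs_no_common_zero[of f1 g1, OF _ cb] p r(1,2) by (simp add: pq)
  have nz2: "c \<noteq> 0 \<or> d \<noteq> 0"
    using invertible_pairs_no_common_zero[of f2 g2, OF _ cb] q r(3,4) by (simp add: pq)
  have "complex_of_real (a * d - b * c) = 0"
    using x by (simp add: pq singular_points_def invertible_det_nz det_2 r)
  then have det: "a * d = b * c"
    by (simp only: of_real_eq_0_iff right_minus_eq)
  have iff: "is_ratio_at p q x l \<longleftrightarrow> c = l * a \<and> d = l * b" for l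
    by (simp add: pq is_ratio_at_def r flip: of_real_mult)
  show "\<exists>!l. is_ratio_at p q x l"
  proof (cases "a = 0")
    case True
    then show ?thesis
      using nz1 det unfolding iff by (intro ex1I[of _ "d / b"]) auto
  next
    case False
    then show ?thesis
      using det unfolding iff by (intro ex1I[of _ "c / a"]) (auto simp: field_simps)
  qed
  show "is_ratio_at p q x l \<Longrightarrow> l \<noteq> 0"
    using nz2 unfolding iff by auto
qed

end

theory Submission
  imports Defs
begin

text \<open>
  A unit of the real disc algebra is real and zero-free on \<open>[-1,1]\<close>, hence has a constant sign
  there. If \<open>(\<alpha>, \<beta>)\<close> stabilizes two pairs at once and the second pair is \<open>\<lambda>\<close> times the first at
  some \<open>x \<in> [-1,1]\<close>, then the same factor relates the two units at \<open>x\<close>, so the sign of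
  \<open>\<lambda>\<close> is the quotient of the signs of the two units. For three pairs whose singular sets are all
  nonempty, the product of the three linking signs would therefore have to be positive, whereas
  pairwise sign-linking says nothing about that product. The pairs
    \<open>(1, 0)\<close>,   \<open>(-z, z + 1)\<close>,   \<open>(z, z - 1)\<close>
  have linking signs \<open>+, +, -\<close>: the three determinants are \<open>z + 1\<close>, \<open>z - 1\<close> and \<open>-2 z\<^sup>2\<close>, so the
  singular sets are \<open>{-1}\<close>, \<open>{1}\<close> and \<open>{0}\<close>, where the ratios are \<open>1\<close>, \<open>1\<close> and \<open>-1\<close>.
\<close>

lemma real_disc_units_nonzero:
  assumes "u \<in> real_disc_units" "z \<in> cball 0 1"
  shows "u z \<noteq> 0"
proof -
  obtain h where "\<forall>z\<in>cball 0 1. u z * h z = 1"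
    using assms(1) by (auto simp: real_disc_units_def)
  then have "u z * h z = 1"
    using assms(2) by blast
  then show ?thesis
    by auto
qed

lemma real_disc_units_same_sign:
  assumes u: "u \<in> real_disc_units" and xy: "x \<in> {-1..1}" "y \<in> {-1..1}"
  shows "Re (u (of_real x)) > 0 \<longleftrightarrow> Re (u (of_real y)) > 0"
proof -
  define r where "r t = Re (u (of_real t))" for t :: real
  have alg: "u \<in> real_disc_algebra"
    using u by (simp add: real_disc_units_def)
  have "continuous_on (cball 0 1) u"
    using alg by (simp add: real_disc_algebra_def disc_algebra_def)
  moreover have "of_real ` {-1..1::real} \<subseteq> cball (0::complex) 1"
    by (auto simp: abs_le_iff)
  ultimately have "continuous_on {-1..1} (\<lambda>t::real. u (of_real t))"
    using continuous_on_compose2 continuous_on_of_real_id by blast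
  then have "continuous_on {-1..1} r"
    unfolding r_def by (rule continuous_on_Re)
  then have conn: "connected (r ` {-1..1})"
    by (intro connected_continuous_image) auto
  have nz: "r t \<noteq> 0" if t: "t \<in> {-1..1}" for t
  proof
    assume "r t = 0"
    then have "u (of_real t) = 0"
      using real_disc_algebra_real_on_interval[OF alg t] by (simp add: r_def)
    moreover have "of_real t \<in> cball (0::complex) 1"
      using t by auto
    ultimately show False
      using real_disc_units_nonzero[OF u] by blast
  qed
  have "r t > 0" if "s \<in> {-1..1}" "t \<in> {-1..1}" "r s > 0" for s t
  proof (rule ccontr)
    assume "\<not> r t > 0"
    then have "r t \<le> 0" "0 \<le> r s"
      using that(3) by simp_all
    then have "0 \<in> r ` {-1..1}"
      using connectedD_interval[OF conn imageI[OF that(2)] imageI[OF that(1)]] by blast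
    then show False
      using nz by (metis imageE)
  qed
  then show ?thesis
    using xy unfolding r_def by blast
qed

lemma singular_points_iff_det:
  "singular_points (f1, g1) (f2, g2) =
     {x \<in> {-1..1}. f1 (of_real x) * g2 (of_real x) = g1 (of_real x) * f2 (of_real x)}"
  by (auto simp: singular_points_def invertible_det_nz det_2)

lemma sign_linkedI_constant_ratio:
  assumes "\<And>x. x \<in> singular_points p q \<Longrightarrow> is_ratio_at p q x l" and "l \<noteq> 0"
  shows "sign_linked p q"
  unfolding sign_linked_def using assms by (intro exI[of _ "\<lambda>_. l"]) auto

lemma real_disc_algebra_affine:
  "(\<lambda>z. of_real a * z + of_real b) \<in> real_disc_algebra"
  unfolding real_disc_algebra_def disc_algebra_def mem_Collect_eq
  by (intro conjI continuous_intros holomorphic_intros) simp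

lemma invertible_pairs_constant_Bezout:
  assumes "f \<in> real_disc_algebra" "g \<in> real_disc_algebra"
    and "\<And>z. of_real a * f z + of_real b * g z = 1"
  shows "(f, g) \<in> invertible_pairs"
proof -
  have "(\<lambda>z. of_real a) \<in> real_disc_algebra" "(\<lambda>z. of_real b) \<in> real_disc_algebra"
    using real_disc_algebra_affine[of 0] by simp_all
  then show ?thesis
    using assms(1,2) unfolding invertible_pairs_def mem_Collect_eq prod.case
    by (intro conjI bexI[of _ "\<lambda>z. of_real a"] bexI[of _ "\<lambda>z. of_real b"] ballI assms(3))
qed

theorem theorem0p3:
  shows "\<exists>f1 g1 f2 g2 f3 g3.
    (f1, g1) \<in> invertible_pairs \<and> (f2, g2) \<in> invertible_pairs \<and> (f3, g3) \<in> invertible_pairs \<and>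
    sign_linked (f1, g1) (f2, g2) \<and>
    sign_linked (f1, g1) (f3, g3) \<and>
    sign_linked (f2, g2) (f3, g3) \<and>
    \<not> simultaneously_stabilizable {(f1, g1), (f2, g2), (f3, g3)}"
proof -
  define f1 g1 f2 g2 f3 g3 :: "complex \<Rightarrow> complex"
    where defs: "f1 = (\<lambda>z. 1)" "g1 = (\<lambda>z. 0)" "f2 = (\<lambda>z. - z)" "g2 = (\<lambda>z. z + 1)"
      "f3 = (\<lambda>z. z)" "g3 = (\<lambda>z. z - 1)"
  have alg: "f1 \<in> real_disc_algebra" "g1 \<in> real_disc_algebra" "f2 \<in> real_disc_algebra"
      "g2 \<in> real_disc_algebra" "f3 \<in> real_disc_algebra" "g3 \<in> real_disc_algebra"
    using real_disc_algebra_affine[of 0 1] real_disc_algebra_affine[of 0 0]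
      real_disc_algebra_affine[of "-1" 0] real_disc_algebra_affine[of 1 1]
      real_disc_algebra_affine[of 1 0] real_disc_algebra_affine[of 1 "-1"]
    by (simp_all add: defs)
  have inv1: "(f1, g1) \<in> invertible_pairs"
    using alg by (intro invertible_pairs_constant_Bezout[where a = 1 and b = 0]) (simp_all add: defs)
  have inv2: "(f2, g2) \<in> invertible_pairs"
    using alg by (intro invertible_pairs_constant_Bezout[where a = 1 and b = 1]) (simp_all add: defs)
  have inv3: "(f3, g3) \<in> invertible_pairs"
    using alg by (intro invertible_pairs_constant_Bezout[where a = 1 and b = "-1"]) (simp_all add: defs)
  have sing12: "x = -1" if "x \<in> singular_points (f1, g1) (f2, g2)" for x
  proof -
    have "complex_of_real (x + 1) = 0"
      using that by (simp add: singular_points_iff_det defs)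
    then show ?thesis
      by (simp only: of_real_eq_0_iff add_eq_0_iff2)
  qed
  have sing13: "x = 1" if "x \<in> singular_points (f1, g1) (f3, g3)" for x
    using that by (simp add: singular_points_iff_det defs)
  have sing23: "x = 0" if "x \<in> singular_points (f2, g2) (f3, g3)" for x
  proof -
    have "complex_of_real (2 * x\<^sup>2) = 0"
      using that by (simp add: singular_points_iff_det defs algebra_simps power2_eq_square)
    then show ?thesis
      by (simp only: of_real_eq_0_iff) simp
  qed
  have linked12: "sign_linked (f1, g1) (f2, g2)"
    by (rule sign_linkedI_constant_ratio[where l = 1])
      (auto dest!: sing12 simp: is_ratio_at_def, simp_all add: defs)
  have linked13: "sign_linked (f1, g1) (f3, g3)"
    by (rule sign_linkedI_constant_ratio[where l = 1])
      (auto dest!: sing13 simp: is_ratio_at_def, simp_all add: defs)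
  have linked23: "sign_linked (f2, g2) (f3, g3)"
    by (rule sign_linkedI_constant_ratio[where l = "-1"])
      (auto dest!: sing23 simp: is_ratio_at_def, simp_all add: defs)
  have "\<not> simultaneously_stabilizable {(f1, g1), (f2, g2), (f3, g3)}"
  proof
    assume "simultaneously_stabilizable {(f1, g1), (f2, g2), (f3, g3)}"
    then obtain \<alpha> \<beta> where
      u1: "\<alpha> \<in> real_disc_units" and
      u2: "(\<lambda>z. \<alpha> z * - z + \<beta> z * (z + 1)) \<in> real_disc_units" and
      u3: "(\<lambda>z. \<alpha> z * z + \<beta> z * (z - 1)) \<in> real_disc_units" and
      b: "\<beta> \<in> real_disc_algebra"
      by (auto simp: simultaneously_stabilizable_def defs)
    \<comment> \<open>Go around the triangle of pairs, changing pair only at a singular point.\<close>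
    have "Re (\<beta> 0) > 0 \<longleftrightarrow> Re (\<alpha> (-1)) > 0"
      using real_disc_units_same_sign[OF u2, of 0 "-1"] by simp
    also have "\<dots> \<longleftrightarrow> Re (\<alpha> 1) > 0"
      using real_disc_units_same_sign[OF u1, of "-1" 1] by simp
    also have "\<dots> \<longleftrightarrow> Re (\<beta> 0) < 0"
      using real_disc_units_same_sign[OF u3, of 1 0] by simp
    finally have "Re (\<beta> 0) = 0"
      by linarith
    then have "\<beta> 0 = 0"
      using real_disc_algebra_real_on_interval[OF b, of 0] by simp
    \<comment> \<open>The second unit takes the value \<open>\<beta> 0\<close> at the origin.\<close>
    then show False
      using real_disc_units_nonzero[OF u2, of 0] by simp
  qed
  then show ?thesis
    using inv1 inv2 inv3 linked12 linked13 linked23 by blast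
qed

end
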